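(* Let $R=\bigoplus_{i=1}^{\infty}R_i$ be a ring graded by the additive semigroup of positive integers, and suppose that $R$ is a Jacobson radical ring. Then every subring $S$ of $R$ which is generated (as a subring) by homogeneous elements of $R$ is a Jacobson radical ring.
   Context: Rings are associative and are not assumed to have an identity element; subrings are accordingly not required to contain an identity (a subring is an additive subgroup closed under multiplication). A ring graded by the additive semigroup of positive integers is a ring $R$ with a decomposition $R=\bigoplus_{i=1}^{\infty}R_i$ into additive subgroups with $R_iR_j\subseteq R_{i+j}$ for all $i,j\geq 1$. An element is homogeneous if it lies in some $R_i$. A ring $R$ is called a Jacobson radical ring if the Jacobson radical of $R$ equals $R$; equivalently, for every $a\in R$ there is $a'\in R$ with $a+a'+aa'=a+a'+a'a=0$. *)

theory Defs
  imports Main HOL.Hull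
begin

text \<open>The type class \<open>ring\<close> consists of the associative rings that need not have an identity.
  The ambient ring is a whole type; its subrings are sets.\<close>

definition additive_subgroup :: "'a::ring set \<Rightarrow> bool" where
  "additive_subgroup A \<longleftrightarrow> 0 \<in> A \<and> (\<forall>x\<in>A. \<forall>y\<in>A. x + y \<in> A) \<and> (\<forall>x\<in>A. - x \<in> A)"

definition subring :: "'a::ring set \<Rightarrow> bool" where
  "subring S \<longleftrightarrow> additive_subgroup S \<and> (\<forall>x\<in>S. \<forall>y\<in>S. x * y \<in> S)"

definition generated_subring :: "'a::ring set \<Rightarrow> 'a set" where
  "generated_subring X = subring hull X"

definition ideal_of :: "'a::ring set \<Rightarrow> 'a set \<Rightarrow> bool" where
  "ideal_of I S \<longleftrightarrow> I \<subseteq> S \<and> additive_subgroup I \<and> (\<forall>x\<in>I. \<forall>s\<in>S. s * x \<in> I \<and> x * s \<in> I)"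

definition quasi_regular_in :: "'a::ring set \<Rightarrow> 'a \<Rightarrow> bool" where
  "quasi_regular_in S a \<longleftrightarrow> (\<exists>a'\<in>S. a + a' + a * a' = 0 \<and> a + a' + a' * a = 0)"

text \<open>The Jacobson radical of a ring without identity is its largest quasi-regular ideal,
  which is the union of all its quasi-regular ideals.\<close>

definition jacobson_radical :: "'a::ring set \<Rightarrow> 'a set" where
  "jacobson_radical S = \<Union>{I. ideal_of I S \<and> (\<forall>a\<in>I. quasi_regular_in S a)}"

definition jacobson_radical_ring :: "'a::ring set \<Rightarrow> bool" where
  "jacobson_radical_ring S \<longleftrightarrow> subring S \<and> jacobson_radical S = S"

text \<open>The components are \<open>R i\<close> for \<open>i \<ge> 1\<close>; the value \<open>R 0\<close> is never used.
  The last conjunct says that the ring is the internal direct sum of the components.\<close>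

definition positively_graded :: "(nat \<Rightarrow> 'a::ring set) \<Rightarrow> bool" where
  "positively_graded R \<longleftrightarrow>
     (\<forall>i\<ge>1. additive_subgroup (R i)) \<and>
     (\<forall>i\<ge>1. \<forall>j\<ge>1. \<forall>x\<in>R i. \<forall>y\<in>R j. x * y \<in> R (i + j)) \<and>
     (\<forall>x. \<exists>!c. c 0 = 0 \<and> (\<forall>i\<ge>1. c i \<in> R i) \<and> finite {i. c i \<noteq> 0} \<and>
               x = (\<Sum>i | c i \<noteq> 0. c i))"

definition homogeneous :: "(nat \<Rightarrow> 'a::ring set) \<Rightarrow> 'a \<Rightarrow> bool" where
  "homogeneous R x \<longleftrightarrow> (\<exists>i\<ge>1. x \<in> R i)"

lemma subring_generated_subring: "subring (generated_subring X)"
  unfolding generated_subring_def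
  by (rule hull_in) (auto simp: subring_def additive_subgroup_def)

lemma jacobson_radical_ring_iff:
  "jacobson_radical_ring S \<longleftrightarrow>
     subring S \<and> (\<forall>a\<in>S. \<exists>a'\<in>S. a + a' + a * a' = 0 \<and> a + a' + a' * a = 0)"
proof -
  have "jacobson_radical S = S \<longleftrightarrow> (\<forall>a\<in>S. quasi_regular_in S a)" if "subring S"
  proof
    assume "jacobson_radical S = S"
    then show "\<forall>a\<in>S. quasi_regular_in S a"
      unfolding jacobson_radical_def by blast
  next
    assume "\<forall>a\<in>S. quasi_regular_in S a"
    moreover have "ideal_of S S"
      using that by (simp add: ideal_of_def subring_def)
    ultimately show "jacobson_radical S = S"
      unfolding jacobson_radical_def by (auto simp: ideal_of_def)
  qed
  then show ?thesis
    unfolding jacobson_radical_ring_def quasi_regular_in_def by blast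
qed

end

theory Submission
  imports Defs
begin

text \<open>
  Since every component has positive degree, the product of homogeneous elements has a larger
  degree than either factor. Hence the equation \<open>a + a' + a * a' = 0\<close>, read in degree \<open>m\<close>,
  expresses the component of \<open>a'\<close> in degree \<open>m\<close> through components of \<open>a\<close> and components of
  \<open>a'\<close> of degree below \<open>m\<close>:
  \<open>a'\<^sub>m = - a\<^sub>m - (\<Sum>i | 0 < i \<and> i < m. a\<^sub>i * a'\<^bsub>m-i\<^esub>)\<close>.
  A subring \<open>S\<close> generated by homogeneous elements contains the components of all its elements
  (\<open>component_mem_generated_subring\<close>). So if \<open>a \<in> S\<close>, then by induction on \<open>m\<close> every component of
  a quasi-inverse \<open>a'\<close> of \<open>a\<close> in the whole ring lies in \<open>S\<close>
  (\<open>component_quasi_inverse_mem\<close>), and \<open>a'\<close>, the finite sum of its components, lies in \<open>S\<close> too.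
\<close>

definition component :: "(nat \<Rightarrow> 'a::ring set) \<Rightarrow> 'a \<Rightarrow> nat \<Rightarrow> 'a" where
  "component R x = (THE c. c 0 = 0 \<and> (\<forall>i\<ge>1. c i \<in> R i) \<and> finite {i. c i \<noteq> 0} \<and>
                           x = (\<Sum>i | c i \<noteq> 0. c i))"

lemma component_decomposition:
  assumes "positively_graded R"
  shows "component R x 0 = 0" and "i \<ge> 1 \<Longrightarrow> component R x i \<in> R i"
    and "finite {i. component R x i \<noteq> 0}"
    and "x = (\<Sum>i | component R x i \<noteq> 0. component R x i)"
proof -
  have "\<exists>!c. c 0 = 0 \<and> (\<forall>i\<ge>1. c i \<in> R i) \<and> finite {i. c i \<noteq> 0} \<and>
             x = (\<Sum>i | c i \<noteq> 0. c i)"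
    using assms unfolding positively_graded_def by blast
  note * = theI'[OF this, folded component_def]
  show "component R x 0 = 0" and "i \<ge> 1 \<Longrightarrow> component R x i \<in> R i"
    and "finite {i. component R x i \<noteq> 0}"
    and "x = (\<Sum>i | component R x i \<noteq> 0. component R x i)"
    using * by auto
qed

lemma component_eqI:
  assumes "positively_graded R" and "c 0 = 0" and "\<And>i. i \<ge> 1 \<Longrightarrow> c i \<in> R i"
    and "\<And>i. n < i \<Longrightarrow> c i = 0" and "x = (\<Sum>i\<le>n. c i)"
  shows "component R x = c"
proof -
  have support: "{i. c i \<noteq> 0} \<subseteq> {..n}"
    using assms(4) by (auto simp: not_less[symmetric])
  then have "x = (\<Sum>i | c i \<noteq> 0. c i)"
    unfolding assms(5) by (intro sum.mono_neutral_right) auto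
  moreover have "finite {i. c i \<noteq> 0}"
    using support finite_subset by blast
  moreover have "\<exists>!c. c 0 = 0 \<and> (\<forall>i\<ge>1. c i \<in> R i) \<and> finite {i. c i \<noteq> 0} \<and>
                      x = (\<Sum>i | c i \<noteq> 0. c i)"
    using assms(1) unfolding positively_graded_def by blast
  ultimately show ?thesis
    unfolding component_def using assms(2,3) by (intro the1_equality) auto
qed

lemma component_bounded:
  assumes "positively_graded R"
  obtains n where "\<And>k i. n \<le> k \<Longrightarrow> k < i \<Longrightarrow> component R x i = 0"
    and "\<And>k. n \<le> k \<Longrightarrow> x = (\<Sum>i\<le>k. component R x i)"
proof -
  obtain n where n: "\<forall>i\<in>{i. component R x i \<noteq> 0}. i \<le> n"
    using component_decomposition(3)[OF assms] finite_nat_set_iff_bounded_le by blast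
  have vanish: "component R x i = 0" if "n < i" for i
    using n that by force
  have "x = (\<Sum>i\<le>k. component R x i)" if "n \<le> k" for k
  proof -
    have "(\<Sum>i | component R x i \<noteq> 0. component R x i) = (\<Sum>i\<le>k. component R x i)"
      using n that by (intro sum.mono_neutral_left) force+
    then show ?thesis
      using component_decomposition(4)[OF assms, of x] by simp
  qed
  with vanish show thesis
    by (intro that[of n]) auto
qed

lemma additive_subgroup_sum:
  assumes "additive_subgroup A" and "\<And>i. i \<in> I \<Longrightarrow> f i \<in> A"
  shows "sum f I \<in> A"
  using assms(2)
  by (induction I rule: infinite_finite_induct)
    (use assms(1) in \<open>auto simp: additive_subgroup_def\<close>)

lemma additive_subgroup_component:
  assumes "positively_graded R" and "i \<ge> 1"
  shows "additive_subgroup (R i)"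
  using assms unfolding positively_graded_def by blast

lemma component_zero:
  assumes "positively_graded R"
  shows "component R 0 = (\<lambda>_. 0)"
  using additive_subgroup_component[OF assms]
  by (intro component_eqI[OF assms, where n = 0]) (auto simp: additive_subgroup_def)

lemma component_homogeneous:
  assumes "positively_graded R" and "d \<ge> 1" and "x \<in> R d"
  shows "component R x = (\<lambda>i. if i = d then x else 0)"
  using additive_subgroup_component[OF assms(1)] assms(2,3)
  by (intro component_eqI[OF assms(1), where n = d]) (auto simp: additive_subgroup_def)

lemma component_add:
  assumes "positively_graded R"
  shows "component R (x + y) = (\<lambda>i. component R x i + component R y i)"
proof -
  obtain n m where n: "\<And>k i. n \<le> k \<Longrightarrow> k < i \<Longrightarrow> component R x i = 0"
      "\<And>k. n \<le> k \<Longrightarrow> x = (\<Sum>i\<le>k. component R x i)"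
    and m: "\<And>k i. m \<le> k \<Longrightarrow> k < i \<Longrightarrow> component R y i = 0"
      "\<And>k. m \<le> k \<Longrightarrow> y = (\<Sum>i\<le>k. component R y i)"
    using component_bounded[OF assms, of x] component_bounded[OF assms, of y] by metis
  show ?thesis
  proof (rule component_eqI[OF assms, where n = "n + m"])
    show "x + y = (\<Sum>i\<le>n + m. component R x i + component R y i)"
      using n(2)[of "n + m"] m(2)[of "n + m"] by (simp add: sum.distrib)
    show "component R x i + component R y i = 0" if "n + m < i" for i
      using n(1)[of "n + m" i] m(1)[of "n + m" i] that by simp
    show "component R x i + component R y i \<in> R i" if "i \<ge> 1" for i
      using additive_subgroup_component[OF assms that] component_decomposition(2)[OF assms that]
      by (simp add: additive_subgroup_def)
  qed (simp add: component_decomposition(1)[OF assms])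
qed

lemma component_minus:
  assumes "positively_graded R"
  shows "component R (- x) i = - component R x i"
proof -
  have "component R x i + component R (- x) i = 0"
    using fun_cong[OF component_add[OF assms, of x "- x"], of i]
    by (simp add: component_zero[OF assms])
  then show ?thesis
    by (simp add: eq_neg_iff_add_eq_0 add.commute)
qed

text \<open>The terms with \<open>i = 0\<close> and \<open>i = m\<close> vanish, because degree-zero components are zero by
  convention; including them gives the usual convolution over \<open>{..m}\<close>.\<close>

lemma component_mult:
  assumes "positively_graded R"
  shows "component R (x * y) = (\<lambda>m. \<Sum>i\<le>m. component R x i * component R y (m - i))"
proof -
  let ?a = "component R x" and ?b = "component R y"
  obtain n m where n: "\<And>k i. n \<le> k \<Longrightarrow> k < i \<Longrightarrow> ?a i = 0" "\<And>k. n \<le> k \<Longrightarrow> x = (\<Sum>i\<le>k. ?a i)"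
    and m: "\<And>k i. m \<le> k \<Longrightarrow> k < i \<Longrightarrow> ?b i = 0" "\<And>k. m \<le> k \<Longrightarrow> y = (\<Sum>i\<le>k. ?b i)"
    using component_bounded[OF assms, of x] component_bounded[OF assms, of y] by metis
  note zero = component_decomposition(1)[OF assms]
  show ?thesis
  proof (rule component_eqI[OF assms, where n = "n + m"])
    have "x * y = (\<Sum>i\<le>n. ?a i) * (\<Sum>j\<le>m. ?b j)"
      using n(2)[of n] m(2)[of m] by simp
    also have "\<dots> = (\<Sum>(i, j)\<in>{..n} \<times> {..m}. ?a i * ?b j)"
      by (simp add: sum_product sum.cartesian_product)
    also have "\<dots> = (\<Sum>(i, j)\<in>{(i, j). i + j \<le> n + m}. ?a i * ?b j)"
    proof (rule sum.mono_neutral_left)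
      show "finite {(i, j). i + j \<le> n + m}"
        by (rule finite_subset[of _ "{..n + m} \<times> {..n + m}"]) auto
      have "?a i * ?b j = 0" if "\<not> (i \<le> n \<and> j \<le> m)" for i j
        using that n(1)[of n i] m(1)[of m j] by (cases "n < i") auto
      then show "\<forall>p\<in>{(i, j). i + j \<le> n + m} - {..n} \<times> {..m}. (case p of (i, j) \<Rightarrow> ?a i * ?b j) = 0"
        by (simp add: split_def mem_Times_iff)
    qed auto
    also have "\<dots> = (\<Sum>k\<le>n + m. \<Sum>i\<le>k. ?a i * ?b (k - i))"
      by (rule sum.triangle_reindex_eq)
    finally show "x * y = (\<Sum>k\<le>n + m. \<Sum>i\<le>k. ?a i * ?b (k - i))" .
    show "(\<Sum>i\<le>k. ?a i * ?b (k - i)) = 0" if "n + m < k" for k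
    proof (intro sum.neutral ballI)
      fix i assume "i \<in> {..k}"
      with that have "n < i \<or> m < k - i" by auto
      then show "?a i * ?b (k - i) = 0"
        using n(1)[of n i] m(1)[of m "k - i"] by auto
    qed
    show "(\<Sum>i\<le>k. ?a i * ?b (k - i)) \<in> R k" if "k \<ge> 1" for k
    proof (rule additive_subgroup_sum[OF additive_subgroup_component[OF assms that]])
      fix i assume "i \<in> {..k}"
      then consider "i = 0 \<or> i = k" | "1 \<le> i" "1 \<le> k - i" "i + (k - i) = k"
        by force
      then show "?a i * ?b (k - i) \<in> R k"
      proof cases
        case 1
        then show ?thesis
          using additive_subgroup_component[OF assms that] by (auto simp: zero additive_subgroup_def)
      next
        case 2
        have "?a i * ?b (k - i) \<in> R (i + (k - i))"
          using assms component_decomposition(2)[OF assms 2(1)]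
            component_decomposition(2)[OF assms 2(2)] 2(1,2)
          unfolding positively_graded_def by blast
        then show ?thesis by (simp only: 2(3))
      qed
    qed
  qed (simp add: zero)
qed

text \<open>For \<open>S\<close> generated by homogeneous elements, this subring contains the generators, so it
  contains all of \<open>S\<close>; that is how \<open>S\<close> is seen to be closed under taking components.\<close>

lemma subring_components_in:
  assumes "positively_graded R" and "subring S"
  shows "subring {x. \<forall>i. component R x i \<in> S}"
proof -
  have S: "additive_subgroup S" "\<And>x y. x \<in> S \<Longrightarrow> y \<in> S \<Longrightarrow> x * y \<in> S"
    using assms(2) by (auto simp: subring_def)
  show ?thesis
    unfolding subring_def additive_subgroup_def
    using S(1)
    by (auto simp: component_zero[OF assms(1)] component_add[OF assms(1)]
        component_minus[OF assms(1)] component_mult[OF assms(1)] additive_subgroup_def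
        intro!: additive_subgroup_sum[OF S(1)] S(2))
qed

lemma component_mem_generated_subring:
  assumes "positively_graded R" and "\<forall>x\<in>X. homogeneous R x" and "a \<in> generated_subring X"
  shows "component R a i \<in> generated_subring X"
proof -
  let ?S = "generated_subring X"
  have "0 \<in> ?S"
    using subring_generated_subring[of X] by (simp add: subring_def additive_subgroup_def)
  moreover have "X \<subseteq> ?S"
    by (simp add: generated_subring_def hull_subset)
  moreover have "component R x i = 0 \<or> component R x i = x" if "x \<in> X" for x i
    using assms(2) that component_homogeneous[OF assms(1)] unfolding homogeneous_def by metis
  ultimately have "component R x i \<in> ?S" if "x \<in> X" for x i
    using that by (metis subsetD)
  then have "X \<subseteq> {x. \<forall>i. component R x i \<in> ?S}"
    by blast
  then have "?S \<subseteq> {x. \<forall>i. component R x i \<in> ?S}"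
    unfolding generated_subring_def
    by (rule hull_minimal)
      (use subring_components_in[OF assms(1) subring_generated_subring[of X]] in
        \<open>simp add: generated_subring_def\<close>)
  then show ?thesis
    using assms(3) by blast
qed

text \<open>In degree \<open>m\<close>, the product \<open>a * b\<close> involves only components of \<open>b\<close> of degree below \<open>m\<close>,
  because \<open>a\<close> has no component of degree zero; this makes the induction work.\<close>

lemma component_quasi_inverse_mem:
  assumes "positively_graded R" and "subring S" and "\<And>i. component R a i \<in> S"
    and "a + b + a * b = 0"
  shows "component R b m \<in> S"
proof (induction m rule: less_induct)
  case (less m)
  have S: "additive_subgroup S" "\<And>x y. x \<in> S \<Longrightarrow> y \<in> S \<Longrightarrow> x * y \<in> S"
    using assms(2) by (auto simp: subring_def)
  let ?s = "\<Sum>i\<le>m. component R a i * component R b (m - i)"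
  have "?s \<in> S"
  proof (rule additive_subgroup_sum[OF S(1)])
    fix i assume "i \<in> {..m}"
    then consider "i = 0" | "m - i < m"
      by force
    then show "component R a i * component R b (m - i) \<in> S"
    proof cases
      case 1
      then show ?thesis
        using S(1) by (simp add: component_decomposition(1)[OF assms(1)] additive_subgroup_def)
    qed (intro S(2) assms(3) less.IH)
  qed
  moreover have "component R a m + component R b m + ?s = 0"
    using arg_cong[OF assms(4), of "\<lambda>x. component R x m"]
    by (simp add: component_zero[OF assms(1)] component_add[OF assms(1)] component_mult[OF assms(1)])
  then have "component R b m = - (component R a m + ?s)"
    by (simp add: eq_neg_iff_add_eq_0 algebra_simps)
  ultimately show ?case
    using S(1) assms(3)[of m] by (simp only: additive_subgroup_def)
qed

theorem proposition0p1:
  fixes R :: "nat \<Rightarrow> 'a::ring set"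
    and X S :: "'a set"
  assumes "positively_graded R"
    and "jacobson_radical_ring (UNIV :: 'a set)"
    and "\<forall>x\<in>X. homogeneous R x"
    and "S = generated_subring X"
  shows "jacobson_radical_ring S"
  unfolding jacobson_radical_ring_iff
proof (intro conjI ballI)
  show S: "subring S"
    unfolding assms(4) by (rule subring_generated_subring)
  fix a assume "a \<in> S"
  then have a: "component R a i \<in> S" for i
    using component_mem_generated_subring[OF assms(1,3)] unfolding assms(4) by blast
  obtain b where b: "a + b + a * b = 0" "a + b + b * a = 0"
    using assms(2) unfolding jacobson_radical_ring_iff by blast
  have "(\<Sum>i | component R b i \<noteq> 0. component R b i) \<in> S"
    using S component_quasi_inverse_mem[OF assms(1) S a b(1)]
    by (intro additive_subgroup_sum) (auto simp: subring_def)
  then have "b \<in> S"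
    using component_decomposition(4)[OF assms(1), of b] by simp
  with b show "\<exists>a'\<in>S. a + a' + a * a' = 0 \<and> a + a' + a' * a = 0"
    by blast
qed

end
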